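(* Let $A$ be an alphabet and let $X \subseteq A^+$ be a code that is a base. Then $X$ is a maximal uniquely decipherable code if and only if $X^*$ is a full and free submonoid of $A^*$.
   Context: $A^*$ is the monoid of finite words over $A$ under concatenation, with empty word $1$; $A^+ = A^*\setminus\{1\}$. A code is any subset $X \subseteq A^+$; $X^*$ is the submonoid of $A^*$ generated by $X$. Every submonoid $M$ of $A^*$ has a unique minimal set of generators, $(M\setminus\{1\})\setminus(M\setminus\{1\})^2$, called the base of $M$; a code $X$ is a base if it is the base of $X^*$. A code $X$ is uniquely decipherable (UD) if $x_1\cdots x_n = y_1\cdots y_m$ with all $x_i,y_j\in X$ implies $n=m$ and $x_i=y_i$ for all $i$. A UD code $X\subseteq A^+$ is a maximal UD code if it is not properly contained in any other UD code over $A$. Free product: let $N$ be a monoid generated by submonoids $M$ and $L$. An expression $m_1 m_2\cdots m_r$ ($r\ge 0$) of an element of $N$ is in reduced form with respect to $M, L$ if each $m_i \neq 1$, each $m_i$ belongs to $M$ or $L$, and consecutive factors are taken from different ones of the two submonoids. One writes $N = M * L$ if $N$ is generated by $M\cup L$ and every element of $N$ has a unique expression in reduced form with respect to $M, L$ ($L$ may be trivial). For submonoids $M, N$ of $A^*$, $M \preceq N$ means that there is a submonoid $L \subseteq A^*$ with $N = M * L$. This is a partial order on the submonoids of $A^*$. A submonoid of $A^*$ is full if it is maximal with respect to $\preceq$. A monoid is free if it is isomorphic to the monoid $B^*$ for some set $B$. *)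

theory Defs
  imports "HOL-Algebra.Group" "HOL.Hull"
begin

section \<open>Words, codes and their bases\<close>

definition word_monoid :: "'a set \<Rightarrow> 'a list monoid" where
  "word_monoid A = \<lparr>carrier = lists A, mult = (@), one = []\<rparr>"

definition code :: "'a set \<Rightarrow> 'a list set \<Rightarrow> bool" where
  "code A X \<longleftrightarrow> X \<subseteq> lists A - {[]}"

definition gen_submonoid :: "'a set \<Rightarrow> 'a list set \<Rightarrow> 'a list set" where
  "gen_submonoid A X = (\<lambda>M. submonoid M (word_monoid A)) hull X"

definition base_of :: "'a list set \<Rightarrow> 'a list set" where
  "base_of M = (M - {[]}) - {u @ v | u v. u \<in> M - {[]} \<and> v \<in> M - {[]}}"

definition is_base :: "'a set \<Rightarrow> 'a list set \<Rightarrow> bool" where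
  "is_base A X \<longleftrightarrow> base_of (gen_submonoid A X) = X"

definition UD_code :: "'a set \<Rightarrow> 'a list set \<Rightarrow> bool" where
  "UD_code A X \<longleftrightarrow> code A X \<and>
     (\<forall>xs \<in> lists X. \<forall>ys \<in> lists X. concat xs = concat ys \<longrightarrow> xs = ys)"

definition maximal_UD_code :: "'a set \<Rightarrow> 'a list set \<Rightarrow> bool" where
  "maximal_UD_code A X \<longleftrightarrow> UD_code A X \<and> \<not> (\<exists>Y. UD_code A Y \<and> X \<subset> Y)"


section \<open>Free products and full submonoids\<close>

text \<open>The function \<open>s\<close> records from which of the two submonoids the \<open>i\<close>-th factor is taken.\<close>

definition reduced_form :: "'a list set \<Rightarrow> 'a list set \<Rightarrow> 'a list list \<Rightarrow> bool" where
  "reduced_form M L ms \<longleftrightarrow>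
     (\<exists>s :: nat \<Rightarrow> bool.
        (\<forall>i < length ms. ms ! i \<noteq> [] \<and> ms ! i \<in> (if s i then M else L)) \<and>
        (\<forall>i. Suc i < length ms \<longrightarrow> s (Suc i) \<noteq> s i))"

definition is_free_product ::
    "'a set \<Rightarrow> 'a list set \<Rightarrow> 'a list set \<Rightarrow> 'a list set \<Rightarrow> bool" where
  "is_free_product A N M L \<longleftrightarrow>
     submonoid M (word_monoid A) \<and> submonoid L (word_monoid A) \<and>
     N = gen_submonoid A (M \<union> L) \<and>
     (\<forall>w \<in> N. \<exists>!ms. reduced_form M L ms \<and> concat ms = w)"

definition free_factor :: "'a set \<Rightarrow> 'a list set \<Rightarrow> 'a list set \<Rightarrow> bool" where
  "free_factor A M N \<longleftrightarrow> (\<exists>L. is_free_product A N M L)"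

definition full_submonoid :: "'a set \<Rightarrow> 'a list set \<Rightarrow> bool" where
  "full_submonoid A M \<longleftrightarrow> submonoid M (word_monoid A) \<and>
     (\<forall>N. submonoid N (word_monoid A) \<and> free_factor A M N \<longrightarrow> N = M)"


section \<open>Free monoids\<close>

text \<open>
  The alphabet \<open>B\<close> is taken among the sets over the element type of \<open>G\<close>. Lemma
  \<open>is_free_monoidI\<close> below shows that alphabets over other types give nothing more.
\<close>

definition is_free_monoid :: "('b, 'm) monoid_scheme \<Rightarrow> bool" where
  "is_free_monoid G \<longleftrightarrow> (\<exists>B :: 'b set. G \<cong> word_monoid B)"

lemma is_free_monoidI:
  fixes G :: "('b, 'm) monoid_scheme" and B :: "'c set"
  assumes "G \<cong> word_monoid B"
  shows "is_free_monoid G"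
proof -
  obtain h where h: "h \<in> hom G (word_monoid B)" "bij_betw h (carrier G) (lists B)"
    using assms by (auto simp: is_iso_def iso_def word_monoid_def)
  define f where "f b = inv_into (carrier G) h [b]" for b
  have f: "h (f b) = [b]" if "b \<in> B" for b
    unfolding f_def using h(2) that
    by (intro f_inv_into_f) (auto simp: bij_betw_def)
  have inj: "inj_on f B"
    by (rule inj_onI) (metis f list.inject)
  have "bij_betw (map f) (lists B) (lists (f ` B))"
    using inj by (auto simp: bij_betw_def lists_image intro!: inj_on_map_lists)
  with h(2) have "bij_betw (map f \<circ> h) (carrier G) (lists (f ` B))"
    by (rule bij_betw_trans)
  moreover have "map f \<circ> h \<in> hom G (word_monoid (f ` B))"
    using h(1) by (auto simp: hom_def word_monoid_def Pi_def lists_image)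
  ultimately have "G \<cong> word_monoid (f ` B)"
    by (intro is_isoI[of "map f \<circ> h"]) (auto simp: iso_def word_monoid_def)
  then show ?thesis
    unfolding is_free_monoid_def by blast
qed

end

theory Submission
  imports Defs
begin

text \<open>
  A base of a free monoid is a UD code, so freeness of \<open>X\<^sup>*\<close> amounts to \<open>X\<close> being UD. If
  \<open>N = X\<^sup>* * L\<close> with some \<open>w \<in> L - {1}\<close>, then \<open>X \<union> {w}\<close> is UD: grouping the factors of a
  product over \<open>X \<union> {w}\<close> into maximal runs gives a reduced form, and the runs over \<open>X\<close> and
  over \<open>{w}\<close> factorize uniquely. Conversely, if \<open>X \<subset> Y\<close> with \<open>Y\<close> UD, then
  \<open>Y\<^sup>* = X\<^sup>* * (Y - X)\<^sup>*\<close>, so \<open>X\<^sup>*\<close> is not full. Both directions transport the decomposition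
  of words over a disjoint union \<open>P \<union> Q\<close> into alternating runs along \<open>concat\<close>.
\<close>

section \<open>Generated submonoids\<close>

lemma submonoid_word_monoid_iff:
  "submonoid M (word_monoid A) \<longleftrightarrow>
    M \<subseteq> lists A \<and> [] \<in> M \<and> (\<forall>u\<in>M. \<forall>v\<in>M. u @ v \<in> M)"
  by (auto simp: submonoid_def word_monoid_def)

lemma concat_in_submonoid:
  assumes "submonoid M (word_monoid A)" and "xs \<in> lists M"
  shows "concat xs \<in> M"
  using assms(2,1) by induction (auto simp: submonoid_word_monoid_iff)

lemma concat_image_submonoid:
  assumes "X \<subseteq> lists A"
  shows "submonoid (concat ` lists X) (word_monoid A)"
  unfolding submonoid_word_monoid_iff
proof (intro conjI ballI)
  show "concat ` lists X \<subseteq> lists A"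
    using assms by (force simp: lists_eq_set)
  show "[] \<in> concat ` lists X"
    by (force intro: image_eqI[of _ _ "[]"])
  fix u v
  assume "u \<in> concat ` lists X" "v \<in> concat ` lists X"
  then obtain xs ys where "xs \<in> lists X" "ys \<in> lists X" "u = concat xs" "v = concat ys"
    by blast
  then show "u @ v \<in> concat ` lists X"
    by (intro image_eqI[of _ _ "xs @ ys"]) auto
qed

lemma subset_gen_submonoid: "X \<subseteq> gen_submonoid A X"
  unfolding gen_submonoid_def by (rule hull_subset)

lemma gen_submonoid_mono: "X \<subseteq> Y \<Longrightarrow> gen_submonoid A X \<subseteq> gen_submonoid A Y"
  unfolding gen_submonoid_def by (rule hull_mono)

text \<open>Gives every element of the hull a factorization over \<open>X\<close>, which can then be
  cut into runs.\<close>

lemma gen_submonoid_eq: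
  assumes "X \<subseteq> lists A"
  shows "gen_submonoid A X = concat ` lists X"
  unfolding gen_submonoid_def
proof (rule hull_unique)
  show "X \<subseteq> concat ` lists X"
    by (force intro: image_eqI[of _ _ "[_]"])
qed (use assms in \<open>auto intro: concat_image_submonoid concat_in_submonoid dest: lists_mono\<close>)

lemma gen_submonoid_idem:
  assumes "submonoid M (word_monoid A)"
  shows "gen_submonoid A M = M"
  unfolding gen_submonoid_def using assms by (rule hull_same)

section \<open>Reduced forms as alternating lists\<close>

text \<open>An inductive substitute for the function \<open>s\<close> of
  \<open>reduced_form\<close>: swapping the two sets in the recursive call enforces alternation, and
  the first set always supplies the first factor.\<close>

fun alternating :: "'a list set \<Rightarrow> 'a list set \<Rightarrow> 'a list list \<Rightarrow> bool" where
  "alternating M L [] \<longleftrightarrow> True"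
| "alternating M L (m # ms) \<longleftrightarrow> m \<noteq> [] \<and> m \<in> M \<and> alternating L M ms"

lemma alternating_iff:
  "alternating M L ms \<longleftrightarrow>
    (\<forall>i < length ms. ms ! i \<noteq> [] \<and> ms ! i \<in> (if even i then M else L))"
proof (induction M L ms rule: alternating.induct)
  case (2 M L m ms)
  then show ?case
    by (auto simp: All_less_Suc2)
qed simp

lemma reduced_form_iff:
  "reduced_form M L ms \<longleftrightarrow> alternating M L ms \<or> alternating L M ms"
proof
  assume "reduced_form M L ms"
  then obtain s where
    s: "\<And>i. i < length ms \<Longrightarrow> ms ! i \<noteq> [] \<and> ms ! i \<in> (if s i then M else L)"
    and alt: "\<And>i. Suc i < length ms \<Longrightarrow> s (Suc i) \<noteq> s i"
    unfolding reduced_form_def by blast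
  \<comment> \<open>The labelling flips at each step, so \<open>s 0\<close> and parity determine it;
    the two values of \<open>s 0\<close> give the two disjuncts.\<close>
  have "s i \<longleftrightarrow> (s 0 \<longleftrightarrow> even i)" if "i < length ms" for i
    using that
  proof (induction i)
    case (Suc i)
    then show ?case using alt[of i] by auto
  qed simp
  with s have "ms ! i \<noteq> [] \<and> ms ! i \<in> (if s 0 \<longleftrightarrow> even i then M else L)" if "i < length ms" for i
    using that by metis
  then show "alternating M L ms \<or> alternating L M ms"
    unfolding alternating_iff by (cases "s 0") presburger+
next
  assume "alternating M L ms \<or> alternating L M ms"
  then show "reduced_form M L ms"
  proof
    assume "alternating M L ms"
    then show ?thesis
      unfolding reduced_form_def alternating_iff by (intro exI[of _ even]) auto
  next
    assume "alternating L M ms"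
    then show ?thesis
      unfolding reduced_form_def alternating_iff by (intro exI[of _ odd]) auto
  qed
qed

text \<open>The blocks can only be the maximal runs over \<open>P\<close> and over \<open>Q\<close>,
  so they can be read off the flattened list.\<close>

lemma alternating_lists_inject:
  assumes "P \<inter> Q = {}" "alternating (lists P) (lists Q) ms" "alternating (lists P) (lists Q) ns"
    and "concat ms = concat ns"
  shows "ms = ns"
  using assms
proof (induction ms arbitrary: ns P Q)
  case Nil
  then show ?case by (cases ns) auto
next
  case (Cons m ms)
  then obtain n ns' where ns: "ns = n # ns'"
    by (cases ns) auto
  \<comment> \<open>\<open>takeWhile\<close> recovers the first block: a following block is nonempty
    and starts in \<open>Q\<close>, hence outside \<open>P\<close>.\<close>
  have rest: "takeWhile (\<lambda>x. x \<in> P) (k @ concat ks) = k"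
    if "k \<in> lists P" "alternating (lists Q) (lists P) ks" for k ks
  proof -
    have "takeWhile (\<lambda>x. x \<in> P) (concat ks) = []"
    proof (cases ks)
      case (Cons q qs)
      with that Cons.prems(1) show ?thesis by (cases q) auto
    qed simp
    with that show ?thesis
      by (subst takeWhile_append2) auto
  qed
  have "m = n"
    using rest[of m ms] rest[of n ns'] Cons.prems by (auto simp: ns)
  \<comment> \<open>The tails start on the other side, which is why the induction generalizes over
    \<open>P\<close> and \<open>Q\<close>.\<close>
  moreover have "ms = ns'"
    using Cons.prems \<open>m = n\<close> by (intro Cons.IH[of Q P]) (auto simp: ns)
  ultimately show ?case by (simp add: ns)
qed

lemma reduced_form_lists_inject:
  assumes "P \<inter> Q = {}" "reduced_form (lists P) (lists Q) ms" "reduced_form (lists P) (lists Q) ns"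
    and "concat ms = concat ns"
  shows "ms = ns"
proof -
  \<comment> \<open>Forms starting on opposite sides: if both were nonempty, their common first
    letter would lie in both \<open>P'\<close> and \<open>Q'\<close>.\<close>
  have *: "ms = ns"
    if "P' \<inter> Q' = {}" "alternating (lists P') (lists Q') ms" "alternating (lists Q') (lists P') ns"
    for P' Q'
  proof (cases ms; cases ns)
    fix k ks l ls
    assume eq: "ms = k # ks" "ns = l # ls"
    with that assms(4) show ?thesis
      by (cases k; cases l) auto
  qed (use that assms(4) in auto)
  have "Q \<inter> P = {}"
    using assms(1) by blast
  then show ?thesis
    using assms * alternating_lists_inject[of P Q ms ns] alternating_lists_inject[of Q P ms ns]
    unfolding reduced_form_iff by blast
qed

lemma reduced_form_lists_exists:
  assumes "zs \<in> lists (P \<union> Q)"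
  shows "\<exists>ms. reduced_form (lists P) (lists Q) ms \<and> concat ms = zs"
  using assms
proof induction
  case Nil
  show ?case by (rule exI[of _ "[]"]) (simp add: reduced_form_iff)
next
  case (Cons z zs)
  \<comment> \<open>A new letter from \<open>P'\<close> opens its own block if \<open>ms\<close>
    alternates starting with \<open>Q'\<close>, as the empty list does; otherwise it joins the first
    block. Exchanging the sets covers letters from \<open>Q\<close>.\<close>
  have step: "\<exists>ns. reduced_form (lists P') (lists Q') ns \<and> concat ns = z # concat ms"
    if "z \<in> P'" "reduced_form (lists P') (lists Q') ms" for P' Q' ms
  proof (cases "alternating (lists Q') (lists P') ms")
    case True
    with that show ?thesis
      by (intro exI[of _ "[z] # ms"]) (auto simp: reduced_form_iff)
  next
    case False
    with that obtain k ks where "ms = k # ks" "alternating (lists P') (lists Q') (k # ks)"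
      by (cases ms) (auto simp: reduced_form_iff)
    with that show ?thesis
      by (intro exI[of _ "(z # k) # ks"]) (auto simp: reduced_form_iff)
  qed
  from Cons obtain ms where "reduced_form (lists P) (lists Q) ms" "concat ms = zs"
    by blast
  then show ?case
    using Cons.hyps(1) step[of P Q ms] step[of Q P ms] unfolding reduced_form_iff by blast
qed

section \<open>Transport along concatenation\<close>

lemma concat_map_concat: "concat (map concat xsss) = concat (concat xsss)"
  by (induction xsss) auto

text \<open>The lists in \<open>P\<close> and \<open>Q\<close> consist of nonempty words, so a
  nonempty block concatenates to a nonempty word, as a reduced form demands.\<close>

lemma alternating_map_concat:
  assumes "alternating P Q mss" "concat ` P \<subseteq> M" "concat ` Q \<subseteq> L"
    and "P \<subseteq> lists (- {[]})" "Q \<subseteq> lists (- {[]})"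
  shows "alternating M L (map concat mss)"
  using assms
proof (induction P Q mss arbitrary: M L rule: alternating.induct)
  case (2 P Q k mss)
  then have "k \<in> P" "k \<in> lists (- {[]})" "k \<noteq> []"
    by auto
  then have "concat k \<noteq> []" "concat k \<in> M"
    using "2.prems"(2) by (cases k; auto)+
  with 2 show ?case
    by simp
qed simp

lemma reduced_form_map_concat:
  assumes "reduced_form P Q mss" "concat ` P \<subseteq> M" "concat ` Q \<subseteq> L"
    and "P \<subseteq> lists (- {[]})" "Q \<subseteq> lists (- {[]})"
  shows "reduced_form M L (map concat mss)"
  using assms alternating_map_concat[of P Q mss M L] alternating_map_concat[of Q P mss L M]
  unfolding reduced_form_iff by blast

text \<open>Lifts factor by factor: the chosen preimage of a nonempty factor is itself nonempty
  because \<open>concat [] = []\<close>.\<close>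

lemma alternating_image_concatE:
  assumes "alternating (concat ` P) (concat ` Q) ms"
  obtains mss where "alternating P Q mss" "map concat mss = ms"
  using assms
proof (induction ms arbitrary: P Q thesis)
  case Nil
  show ?case by (rule Nil.prems(1)[of "[]"]) auto
next
  case (Cons m ms)
  from Cons.prems(2) obtain k where k: "k \<in> P" "concat k = m" "k \<noteq> []"
    by (auto elim!: imageE) (metis concat.simps(1) concat_eq_Nil_conv)
  from Cons.prems(2) obtain mss where "alternating Q P mss" "map concat mss = ms"
    by (auto intro: Cons.IH[of Q P])
  with k show ?case
    by (intro Cons.prems(1)[of "k # mss"]) auto
qed

lemma reduced_form_image_concatE:
  assumes "reduced_form (concat ` P) (concat ` Q) ms"
  obtains mss where "reduced_form P Q mss" "map concat mss = ms"
  using assms unfolding reduced_form_iff by (metis alternating_image_concatE)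

lemma alternating_map_concat_inject:
  assumes "alternating P Q mss" "alternating P Q nss" "map concat mss = map concat nss"
    and "inj_on concat P" "inj_on concat Q"
  shows "mss = nss"
  using assms
proof (induction mss arbitrary: nss P Q)
  case (Cons m mss)
  then obtain n nss' where "nss = n # nss'"
    by (cases nss) auto
  with Cons.prems Cons.IH[of Q P nss'] show ?case
    by (auto dest: inj_onD)
qed simp

lemma reduced_form_map_concat_inject:
  assumes "reduced_form P Q mss" "reduced_form P Q nss" "map concat mss = map concat nss"
    and "inj_on concat P" "inj_on concat Q" "concat ` P \<inter> concat ` Q \<subseteq> {[]}"
    and "P \<subseteq> lists (- {[]})" "Q \<subseteq> lists (- {[]})"
  shows "mss = nss"
proof -
  \<comment> \<open>If nonempty forms started on opposite sides, their first blocks would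
    concatenate to a common word, hence to the empty one; a nonempty list of nonempty words cannot
    do that.\<close>
  have *: "mss = nss"
    if "alternating P' Q' mss" "alternating Q' P' nss" "concat ` P' \<inter> concat ` Q' \<subseteq> {[]}"
      "P' \<subseteq> lists (- {[]})" for P' Q'
  proof (cases mss; cases nss)
    fix k ks l ls
    assume eq: "mss = k # ks" "nss = l # ls"
    with that have "k \<in> P'" "l \<in> Q'" "k \<noteq> []"
      by auto
    moreover have "concat k = concat l"
      using assms(3) eq by simp
    ultimately have "concat k = []"
      using that(3) by auto
    moreover have "k \<in> lists (- {[]})"
      using \<open>k \<in> P'\<close> that(4) by (rule subsetD[rotated])
    ultimately show ?thesis
      using \<open>k \<noteq> []\<close> by (cases k) auto
  qed (use assms(3) in auto)
  have "concat ` Q \<inter> concat ` P \<subseteq> {[]}"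
    using assms(6) by blast
  then show ?thesis
    using assms(1,2) *[of P Q] *[of Q P] assms(3-8) alternating_map_concat_inject[of P Q mss nss]
      alternating_map_concat_inject[of Q P mss nss]
    unfolding reduced_form_iff by argo
qed

section \<open>Free products and UD codes\<close>

lemma UD_code_iff: "UD_code A X \<longleftrightarrow> code A X \<and> inj_on concat (lists X)"
  by (auto simp: UD_code_def inj_on_def)

text \<open>Powers of a nonempty word are told apart by their lengths.\<close>

lemma inj_on_concat_lists_singleton:
  assumes "w \<noteq> []"
  shows "inj_on concat (lists {w})"
proof (rule inj_onI)
  fix xs ys
  assume *: "xs \<in> lists {w}" "ys \<in> lists {w}" "concat xs = concat ys"
  have rep: "zs = replicate (length zs) w" if "zs \<in> lists {w}" for zs
    using that by induction auto
  have "length (concat zs) = length zs * length w" if "zs \<in> lists {w}" for zs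
    using that by induction auto
  with * assms have "length xs = length ys"
    by (metis length_0_conv mult_right_cancel)
  with * rep show "xs = ys"
    by metis
qed

text \<open>A common nonempty \<open>w\<close> would give \<open>w @ w\<close> two reduced forms:
  \<open>[w @ w]\<close>, and \<open>[w, w]\<close> with its factors counted in different
  submonoids.\<close>

lemma free_product_Int:
  assumes "is_free_product A N M L"
  shows "M \<inter> L \<subseteq> {[]}"
proof
  fix w
  assume w: "w \<in> M \<inter> L"
  have MN: "M \<subseteq> N"
    using assms subset_gen_submonoid[of "M \<union> L" A] by (auto simp: is_free_product_def)
  have "w @ w \<in> M"
    using assms w by (auto simp: is_free_product_def submonoid_word_monoid_iff)
  moreover have "concat [w, w] = w @ w" "concat [w @ w] = w @ w"
    by auto
  moreover have "reduced_form M L [w, w]" "reduced_form M L [w @ w]" if "w \<noteq> []"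
    using that w \<open>w @ w \<in> M\<close> by (auto simp: reduced_form_iff)
  moreover have "[w, w] \<noteq> [w @ w]"
    by simp
  ultimately have "w = []"
    using assms MN unfolding is_free_product_def by (metis subsetD)
  then show "w \<in> {[]}"
    by simp
qed

lemma UD_code_insert:
  assumes X: "UD_code A X" and N: "is_free_product A N (gen_submonoid A X) L"
    and w: "w \<in> L" "w \<noteq> []"
  shows "UD_code A (insert w X)"
proof -
  have XA: "X \<subseteq> lists A" "[] \<notin> X"
    using X by (auto simp: UD_code_def code_def)
  have L: "submonoid L (word_monoid A)"
    using N by (simp add: is_free_product_def)
  then have wA: "w \<in> lists A"
    using w by (auto simp: submonoid_word_monoid_iff)
  \<comment> \<open>\<open>is_free_product\<close> asserts uniqueness for words of \<open>N\<close>;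
    these facts will place \<open>concat xs\<close> there.\<close>
  have LN: "gen_submonoid A X \<union> L \<subseteq> N" "submonoid N (word_monoid A)"
  proof -
    have eq: "N = gen_submonoid A (gen_submonoid A X \<union> L)"
      using N by (simp add: is_free_product_def)
    show "gen_submonoid A X \<union> L \<subseteq> N"
      unfolding eq by (rule subset_gen_submonoid)
    have "gen_submonoid A X \<union> L \<subseteq> lists A"
      using N by (auto simp: is_free_product_def submonoid_word_monoid_iff)
    then show "submonoid N (word_monoid A)"
      by (simp add: eq gen_submonoid_eq concat_image_submonoid)
  qed
  have star: "concat ` lists X = gen_submonoid A X"
    using XA by (simp add: gen_submonoid_eq)
  have wL: "concat ` lists {w} \<subseteq> L"
    using L w by (auto intro!: concat_in_submonoid)
  have disj: "concat ` lists X \<inter> concat ` lists {w} \<subseteq> {[]}"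
    using free_product_Int[OF N] wL star by auto
  have ne: "lists X \<subseteq> lists (- {[]})" "lists {w} \<subseteq> lists (- {[]})"
    using XA w by (auto intro!: lists_mono)
  have "inj_on concat (lists (insert w X))"
  proof (rule inj_onI)
    fix xs ys
    assume xs: "xs \<in> lists (insert w X)" and ys: "ys \<in> lists (insert w X)"
      and eq: "concat xs = concat ys"
    obtain mss where mss: "reduced_form (lists X) (lists {w}) mss" "concat mss = xs"
      using reduced_form_lists_exists[of xs X "{w}"] xs by auto
    obtain nss where nss: "reduced_form (lists X) (lists {w}) nss" "concat nss = ys"
      using reduced_form_lists_exists[of ys X "{w}"] ys by auto
    \<comment> \<open>Concatenating run by run yields reduced forms of one and the same word, so
      uniqueness in \<open>N\<close> identifies their factors.\<close>
    have red: "reduced_form (gen_submonoid A X) L (map concat mss)"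
      "reduced_form (gen_submonoid A X) L (map concat nss)"
      using mss nss star wL ne by (auto intro: reduced_form_map_concat)
    have "insert w X \<subseteq> N"
      using LN(1) w(1) subset_gen_submonoid[of X A] by blast
    then have "concat xs \<in> N"
      using xs LN(2) lists_mono by (blast intro: concat_in_submonoid)
    then have "map concat mss = map concat nss"
      using N red mss(2) nss(2) eq unfolding is_free_product_def
      by (metis concat_map_concat)
    \<comment> \<open>Equal factors come from equal runs: \<open>X\<close> is UD, and a power of
      \<open>w\<close> determines its exponent.\<close>
    then have "mss = nss"
      using mss(1) nss(1) X w ne disj inj_on_concat_lists_singleton[of w]
      by (intro reduced_form_map_concat_inject[of "lists X" "lists {w}"])
        (auto simp: UD_code_iff)
    with mss nss show "xs = ys"
      by simp
  qed
  with XA wA w show ?thesis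
    by (auto simp: UD_code_iff code_def)
qed

lemma maximal_UD_code_imp_full:
  assumes "maximal_UD_code A X"
  shows "full_submonoid A (gen_submonoid A X)"
  unfolding full_submonoid_def
proof (intro conjI allI impI)
  have X: "UD_code A X" and max: "\<And>Y. UD_code A Y \<Longrightarrow> \<not> X \<subset> Y"
    using assms by (auto simp: maximal_UD_code_def)
  then have XA: "X \<subseteq> lists A" "[] \<notin> X"
    by (auto simp: UD_code_def code_def)
  show sub: "submonoid (gen_submonoid A X) (word_monoid A)"
    using XA by (simp add: gen_submonoid_eq concat_image_submonoid)
  fix N
  assume "submonoid N (word_monoid A) \<and> free_factor A (gen_submonoid A X) N"
  then obtain L where N: "is_free_product A N (gen_submonoid A X) L"
    by (auto simp: free_factor_def)
  \<comment> \<open>For nonempty \<open>w\<close>, the code \<open>insert w X\<close> is UD, so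
    maximality puts \<open>w\<close> into \<open>X\<close> and hence into both free factors, which
    meet only in the empty word.\<close>
  have "w = []" if "w \<in> L" for w
  proof (rule ccontr)
    assume "w \<noteq> []"
    with that have "w \<in> X"
      using max[OF UD_code_insert[OF X N]] by blast
    then have "w \<in> gen_submonoid A X"
      using subset_gen_submonoid by blast
    with \<open>w \<noteq> []\<close> that show False
      using free_product_Int[OF N] by blast
  qed
  then have "gen_submonoid A X \<union> L = gen_submonoid A X"
    using sub by (auto simp: submonoid_word_monoid_iff)
  then show "N = gen_submonoid A X"
    using N sub by (simp add: is_free_product_def gen_submonoid_idem)
qed

text \<open>Provides the complement that makes \<open>X^*\<close> a free factor of
  \<open>Y^*\<close>. The UD property recovers the list over \<open>Y\<close> from a word, and
  disjointness of \<open>X\<close> and \<open>Y - X\<close> recovers the runs from the list.\<close>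

lemma free_product_UD_code:
  assumes Y: "UD_code A Y" and "X \<subseteq> Y"
  shows "is_free_product A (gen_submonoid A Y) (gen_submonoid A X) (gen_submonoid A (Y - X))"
  unfolding is_free_product_def
proof (intro conjI ballI)
  have YA: "Y \<subseteq> lists A" "[] \<notin> Y"
    using Y by (auto simp: UD_code_def code_def)
  have XA: "X \<subseteq> lists A" "Y - X \<subseteq> lists A"
    using YA assms(2) by auto
  note eqs = YA(1)[THEN gen_submonoid_eq] XA[THEN gen_submonoid_eq]
  show "submonoid (gen_submonoid A X) (word_monoid A)"
    "submonoid (gen_submonoid A (Y - X)) (word_monoid A)"
    using XA by (simp_all add: eqs concat_image_submonoid)
  show "gen_submonoid A Y = gen_submonoid A (gen_submonoid A X \<union> gen_submonoid A (Y - X))"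
  proof
    have "Y \<subseteq> gen_submonoid A X \<union> gen_submonoid A (Y - X)"
      using subset_gen_submonoid[of X A] subset_gen_submonoid[of "Y - X" A] by blast
    then show "gen_submonoid A Y \<subseteq> gen_submonoid A (gen_submonoid A X \<union> gen_submonoid A (Y - X))"
      by (rule gen_submonoid_mono)
    have "gen_submonoid A X \<union> gen_submonoid A (Y - X) \<subseteq> gen_submonoid A Y"
      using assms(2) by (intro Un_least gen_submonoid_mono) auto
    moreover have "submonoid (gen_submonoid A Y) (word_monoid A)"
      using YA by (simp add: eqs concat_image_submonoid)
    ultimately show "gen_submonoid A (gen_submonoid A X \<union> gen_submonoid A (Y - X)) \<subseteq> gen_submonoid A Y"
      using gen_submonoid_mono gen_submonoid_idem by metis
  qed
  have ne: "lists X \<subseteq> lists (- {[]})" "lists (Y - X) \<subseteq> lists (- {[]})"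
    using YA assms(2) by (auto intro!: lists_mono)
  fix v
  assume "v \<in> gen_submonoid A Y"
  then obtain zs where zs: "zs \<in> lists Y" "concat zs = v"
    by (auto simp: eqs)
  show "\<exists>!ms. reduced_form (gen_submonoid A X) (gen_submonoid A (Y - X)) ms \<and> concat ms = v"
  proof (rule ex_ex1I)
    \<comment> \<open>Existence: cut the factorization into runs and concatenate each of
      them.\<close>
    obtain mss where "reduced_form (lists X) (lists (Y - X)) mss" "concat mss = zs"
      using reduced_form_lists_exists[of zs X "Y - X"] zs assms(2) by (auto simp: Un_absorb1)
    then show "\<exists>ms. reduced_form (gen_submonoid A X) (gen_submonoid A (Y - X)) ms \<and> concat ms = v"
      using zs(2) ne
      by (intro exI[of _ "map concat mss"])
        (auto simp: eqs concat_map_concat intro!: reduced_form_map_concat)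
  next
    \<comment> \<open>Uniqueness: each factor is factorized over its own code, and the resulting
      blocks join to a single list over \<open>Y\<close>.\<close>
    have lift: "\<exists>mss. reduced_form (lists X) (lists (Y - X)) mss \<and> map concat mss = ms
        \<and> concat mss \<in> lists Y"
      if red: "reduced_form (gen_submonoid A X) (gen_submonoid A (Y - X)) ms" for ms
    proof -
      obtain mss where mss: "reduced_form (lists X) (lists (Y - X)) mss" "map concat mss = ms"
        using red unfolding eqs by (rule reduced_form_image_concatE)
      have "mss \<in> lists (lists Y)"
        using mss(1) assms(2)
        unfolding reduced_form_def
        by (auto simp: in_set_conv_nth subset_iff split: if_splits) (metis DiffD1 in_listsD nth_mem)
      then have "concat mss \<in> lists Y"
        by induction auto
      with mss show ?thesis
        by blast
    qed
    fix ms ns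
    assume ms: "reduced_form (gen_submonoid A X) (gen_submonoid A (Y - X)) ms \<and> concat ms = v"
      and ns: "reduced_form (gen_submonoid A X) (gen_submonoid A (Y - X)) ns \<and> concat ns = v"
    obtain mss where mss: "reduced_form (lists X) (lists (Y - X)) mss" "map concat mss = ms"
      "concat mss \<in> lists Y"
      using lift ms by blast
    obtain nss where nss: "reduced_form (lists X) (lists (Y - X)) nss" "map concat nss = ns"
      "concat nss \<in> lists Y"
      using lift ns by blast
    \<comment> \<open>Two layers of \<open>concat\<close> are undone in turn: the outer one because
      \<open>Y\<close> is UD, the inner one by uniqueness of runs.\<close>
    have "concat (concat mss) = concat (concat nss)"
      using ms ns mss(2) nss(2) by (auto simp: concat_map_concat)
    then have "concat mss = concat nss"
      using Y mss(3) nss(3) by (auto simp: UD_code_iff dest: inj_onD)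
    then have "mss = nss"
      using mss(1) nss(1) by (intro reduced_form_lists_inject[of X "Y - X"]) auto
    with mss nss show "ms = ns"
      by simp
  qed
qed

lemma full_imp_maximal_UD_code:
  assumes X: "UD_code A X" and full: "full_submonoid A (gen_submonoid A X)"
  shows "maximal_UD_code A X"
  unfolding maximal_UD_code_def
proof (intro conjI notI X)
  assume "\<exists>Y. UD_code A Y \<and> X \<subset> Y"
  then obtain Y y where Y: "UD_code A Y" "X \<subseteq> Y" and y: "y \<in> Y" "y \<notin> X"
    by blast
  have YA: "Y \<subseteq> lists A" "X \<subseteq> lists A"
    using Y by (auto simp: UD_code_def code_def)
  \<comment> \<open>Fullness is applied to \<open>Y^*\<close> with complement
    \<open>(Y - X)^*\<close>. The equality will give \<open>y\<close> a factorization over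
    \<open>X\<close> besides \<open>[y]\<close>, although \<open>y\<close> is not in
    \<open>X\<close>.\<close>
  have "gen_submonoid A Y = gen_submonoid A X"
  proof -
    have "submonoid (gen_submonoid A Y) (word_monoid A)"
      using YA by (simp add: gen_submonoid_eq concat_image_submonoid)
    with full free_product_UD_code[OF Y] show ?thesis
      unfolding full_submonoid_def free_factor_def by blast
  qed
  moreover have "y \<in> gen_submonoid A Y"
    using y subset_gen_submonoid[of Y A] by blast
  ultimately obtain xs where xs: "xs \<in> lists X" "y = concat xs"
    using YA by (auto simp: gen_submonoid_eq)
  then have "concat [y] = concat xs" "[y] \<in> lists Y" "xs \<in> lists Y"
    using y Y(2) by auto
  then have "[y] = xs"
    using Y(1) unfolding UD_code_def by blast
  with xs(1) y(2) show False
    by (metis Cons_in_lists_iff)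
qed

section \<open>Freeness\<close>

text \<open>The isomorphism sends a word to its unique factorization, with the words of
  \<open>X\<close> as letters.\<close>

lemma UD_code_imp_free:
  assumes X: "UD_code A X"
  shows "is_free_monoid ((word_monoid A)\<lparr>carrier := gen_submonoid A X\<rparr>)"
proof -
  let ?G = "(word_monoid A)\<lparr>carrier := gen_submonoid A X\<rparr>"
  have XA: "X \<subseteq> lists A" and inj: "inj_on concat (lists X)"
    using X by (auto simp: UD_code_iff code_def)
  define h where "h = inv_into (lists X) concat"
  have h: "h (concat xs) = xs" if "xs \<in> lists X" for xs
    unfolding h_def using inj that by (rule inv_into_f_f)
  have "bij_betw h (concat ` lists X) (lists X)"
    unfolding h_def using inj by (intro bij_betw_inv_into inj_on_imp_bij_betw)
  moreover have "h (u @ v) = h u @ h v" if uv: "u \<in> concat ` lists X" "v \<in> concat ` lists X" for u v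
  proof -
    from uv obtain xs ys where xy: "xs \<in> lists X" "ys \<in> lists X" "u = concat xs" "v = concat ys"
      by blast
    then show ?thesis
      using h[of "xs @ ys"] h[of xs] h[of ys] by simp
  qed
  ultimately have "h \<in> iso ?G (word_monoid X)"
    using XA bij_betw_imp_funcset[of h "concat ` lists X" "lists X"]
    by (simp add: iso_def hom_def word_monoid_def gen_submonoid_eq)
  then show ?thesis
    by (intro is_free_monoidI is_isoI)
qed

text \<open>An isomorphism onto a word monoid sends the indecomposable elements to letters.\<close>

lemma free_imp_UD_code:
  assumes X: "code A X" and base: "is_base A X"
    and free: "is_free_monoid ((word_monoid A)\<lparr>carrier := gen_submonoid A X\<rparr>)"
  shows "UD_code A X"
proof -
  let ?M = "gen_submonoid A X"
  have XA: "X \<subseteq> lists A"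
    using X by (auto simp: code_def)
  have sub: "submonoid ?M (word_monoid A)"
    using XA by (simp add: gen_submonoid_eq concat_image_submonoid)
  then have M1: "[] \<in> ?M"
    by (simp add: submonoid_word_monoid_iff)
  have app: "u @ v \<in> ?M" if "u \<in> ?M" "v \<in> ?M" for u v
    using sub that by (simp add: submonoid_word_monoid_iff)
  obtain B :: "'a list set" and h where bij: "bij_betw h ?M (lists B)"
    and hom: "\<And>u v. u \<in> ?M \<Longrightarrow> v \<in> ?M \<Longrightarrow> h (u @ v) = h u @ h v"
    using free by (auto simp: is_free_monoid_def is_iso_def iso_def hom_def word_monoid_def)
  have inj: "inj_on h ?M"
    using bij by (rule bij_betw_imp_inj_on)
  \<comment> \<open>\<open>hom\<close> is defined by products alone, so the unit needs an argument:
    \<open>h []\<close> is idempotent, and lists cancel.\<close>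
  have h1: "h [] = []"
    using hom[OF M1 M1] by simp
  have XM: "X \<subseteq> ?M"
    by (rule subset_gen_submonoid)
  \<comment> \<open>If \<open>h x\<close> had more than one letter, splitting off the first and
    pulling both parts back would factor \<open>x\<close> nontrivially in the submonoid, contrary to
    \<open>is_base\<close>.\<close>
  have letter: "\<exists>b. h x = [b]" if x: "x \<in> X" for x
  proof -
    have "x \<noteq> []"
      using x X by (auto simp: code_def)
    then have "h x \<noteq> []"
      using inj h1 M1 x XM by (metis inj_onD subsetD)
    then obtain b bs where hx: "h x = b # bs"
      by (cases "h x") auto
    have "bs = []"
    proof (rule ccontr)
      assume "bs \<noteq> []"
      have "b # bs \<in> lists B"
        using bij x XM hx by (metis bij_betw_apply subsetD)
      then have "[b] \<in> h ` ?M" "bs \<in> h ` ?M"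
        using bij by (auto simp: bij_betw_def)
      then obtain u v where uv: "u \<in> ?M" "v \<in> ?M" "h u = [b]" "h v = bs"
        by (metis imageE)
      then have "h (u @ v) = h x"
        using hom hx by simp
      then have "x = u @ v"
        using inj_onD[OF inj, of "u @ v" x] app[OF uv(1,2)] x XM by auto
      moreover have "u \<noteq> []" "v \<noteq> []"
        using uv h1 \<open>bs \<noteq> []\<close> by auto
      ultimately have "x \<notin> base_of ?M"
        using uv by (auto simp: base_of_def)
      then show False
        using base x by (simp add: is_base_def)
    qed
    with hx show ?thesis
      by simp
  qed
  have h_concat: "h (concat xs) = concat (map h xs)" if "xs \<in> lists X" for xs
    using that
  proof induction
    case (Cons x xs)
    then have "concat xs \<in> ?M"
      using XA by (auto simp: gen_submonoid_eq)
    with Cons XM show ?case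
      using hom[of x "concat xs"] by auto
  qed (simp add: h1)
  \<comment> \<open>\<open>hd\<close> is applied to singletons here, so it merely extracts the
    letter; the image of a factorization becomes a letterwise map.\<close>
  have letters: "concat (map h xs) = map (hd \<circ> h) xs" if "xs \<in> lists X" for xs
    using that by induction (auto dest!: letter)
  have "inj_on (hd \<circ> h) X"
  proof (rule inj_onI)
    fix x y
    assume "x \<in> X" "y \<in> X" "(hd \<circ> h) x = (hd \<circ> h) y"
    then have "h x = h y"
      using letter[of x] letter[of y] by auto
    with \<open>x \<in> X\<close> \<open>y \<in> X\<close> show "x = y"
      using inj XM by (auto dest: inj_onD)
  qed
  then have "inj_on (map (hd \<circ> h)) (lists X)"
    by (rule inj_on_map_lists)
  moreover have "map (hd \<circ> h) xs = h (concat xs)" if "xs \<in> lists X" for xs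
    using that h_concat letters by simp
  \<comment> \<open>The injective letterwise map factors through \<open>concat\<close>, which is
    therefore injective on \<open>lists X\<close>.\<close>
  ultimately have "inj_on (\<lambda>xs. h (concat xs)) (lists X)"
    by (simp cong: inj_on_cong)
  then have "inj_on concat (lists X)"
    by (auto simp: inj_on_def)
  with X show ?thesis
    by (simp add: UD_code_iff)
qed

theorem theorem4p14:
  fixes A :: "'a set" and X :: "'a list set"
  assumes "code A X" and "is_base A X"
  shows "maximal_UD_code A X \<longleftrightarrow>
    full_submonoid A (gen_submonoid A X) \<and>
    is_free_monoid ((word_monoid A)\<lparr>carrier := gen_submonoid A X\<rparr>)"
  \<comment> \<open>Freeness matches the UD property, under which fullness matches
    maximality.\<close>
  using assms maximal_UD_code_imp_full UD_code_imp_free full_imp_maximal_UD_code free_imp_UD_code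
  unfolding maximal_UD_code_def by metis

end
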